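(* For all integers $p \ge 6$ and $q \ge 5$, $$r_4(p,q) \ge 2\, r_4(p-1,q) - 1.$$ Furthermore, for all integers $p \ge 6$ and $q \ge 7$, $$r_4(p,q) \ge (p-1)\cdot\bigl(r_4(p-1,q)-1\bigr) + 1.$$
   Context: For integers $k,p,q$, the Ramsey number $r_k(p,q)$ is the smallest integer $N$ such that for every coloring of all $k$-element subsets of $\{1,\dots,N\}$ with the colors red and blue, there exist either $p$ elements of $\{1,\dots,N\}$ all of whose $k$-element subsets are red, or $q$ elements of $\{1,\dots,N\}$ all of whose $k$-element subsets are blue. *)

theory Defs
  imports "HOL-Library.Ramsey"
begin

text \<open>Colour 0 is red (clique size \<open>p\<close>), colour 1 is blue (clique size \<open>q\<close>).\<close>

definition ramsey_number :: "nat \<Rightarrow> nat \<Rightarrow> nat \<Rightarrow> nat"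
  where "ramsey_number k p q = (LEAST N. partn_lst {1..N} [p, q] k)"

lemma ex_partn_lst_atLeastAtMost: "\<exists>N::nat. partn_lst {1..N} [p, q] k"
proof -
  obtain N :: nat where N: "partn_lst {..<N} [p, q] k"
    using ramsey_full by blast
  have "partn_lst {1..N} [p, q] k"
    unfolding partn_lst_def
  proof
    fix f assume f: "f \<in> nsets {1..N} k \<rightarrow> {..<length [p, q]}"
    have shift: "Suc ` X \<in> nsets {1..N} n" if "X \<in> nsets {..<N} n" for X n
      using that by (auto simp: nsets_def card_image)
    have "(\<lambda>X. f (Suc ` X)) \<in> nsets {..<N} k \<rightarrow> {..<length [p, q]}"
      using f shift by (intro funcsetI) (rule funcset_mem)
    from partn_lstE [OF N this refl]
    obtain i H where i: "i < length [p, q]" and H: "H \<in> nsets {..<N} ([p, q] ! i)"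
      and mono: "(\<lambda>X. f (Suc ` X)) ` nsets H k \<subseteq> {i}" .
    have "f Y = i" if "Y \<in> nsets (Suc ` H) k" for Y
    proof -
      have Y: "Y \<subseteq> Suc ` H" "finite Y" "card Y = k"
        using that by (simp_all add: nsets_def)
      obtain X where X: "X \<subseteq> H" "Y = Suc ` X"
        using Y(1) by (rule subset_imageE)
      with Y have "X \<in> nsets H k"
        by (simp add: nsets_def card_image finite_image_iff)
      with mono have "f (Suc ` X) \<in> {i}"
        by (rule subsetD[OF _ imageI])
      with X show ?thesis
        by simp
    qed
    then have "f ` nsets (Suc ` H) k \<subseteq> {i}"
      by (simp add: image_subset_iff)
    with i shift [OF H] show "\<exists>i<length [p, q]. monochromatic {1..N} ([p, q] ! i) k f i"
      unfolding monochromatic_def by (intro exI conjI bexI)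
  qed
  then show ?thesis ..
qed

lemma partn_lst_ramsey_number: "partn_lst {1..ramsey_number k p q} [p, q] k"
  unfolding ramsey_number_def by (rule LeastI_ex) (rule ex_partn_lst_atLeastAtMost)

lemma ramsey_number_le: "partn_lst {1..N} [p, q] k \<Longrightarrow> ramsey_number k p q \<le> N"
  unfolding ramsey_number_def by (rule Least_le)

end

theory Submission
  imports Defs
begin

text \<open>
  Both inequalities come from one product construction.  Take a colouring of the 4-subsets of a set
  \<open>V\<close> without a red \<open>(p - 1)\<close>-set and without a blue \<open>q\<close>-set, and replace \<open>V\<close> by several disjoint
  copies of itself, called blocks.  Inside a block the given colouring is kept; a 4-subset that meets
  several blocks is coloured by the sizes of its intersections with them:
  \<open>3+1\<close> and \<open>1+1+1+1\<close> are red, \<open>2+2\<close> and \<open>2+1+1\<close> are blue.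

  A red set with two points in one block has at most one point outside that block, hence has size at
  most \<open>(p - 2) + 1\<close>; a red set with no two points in one block is at most as large as the number of
  blocks.  A blue set that is not contained in one block has at most two points in each block and
  meets at most three blocks.  Thus, if there are at most \<open>p - 1\<close> blocks and \<open>q\<close> exceeds \<open>6\<close> (or just
  \<open>4\<close> for two blocks), there is no red \<open>p\<close>-set and no blue \<open>q\<close>-set.  With \<open>V\<close> of size
  \<open>r\<^sub>4(p - 1, q) - 1\<close>, two blocks yield the first inequality and \<open>p - 1\<close> blocks the second.
\<close>

section \<open>The block colouring\<close>

text \<open>
  The colouring of the 4-subsets of a union of copies of \<open>V\<close>: \<open>\<beta> x\<close> is the block of the point \<open>x\<close>,
  \<open>\<pi> x\<close> is its position in \<open>V\<close>, and \<open>f\<close> is the colouring on \<open>V\<close>.  When a 4-set meets exactly two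
  blocks, it is of type \<open>3+1\<close> if and only if some point of it is alone in its block.
\<close>

definition block_colouring :: "('a \<Rightarrow> 'b) \<Rightarrow> ('a \<Rightarrow> 'c) \<Rightarrow> ('c set \<Rightarrow> nat) \<Rightarrow> 'a set \<Rightarrow> nat"
  where "block_colouring \<beta> \<pi> f X =
    (if card (\<beta> ` X) = 1 then f (\<pi> ` X)
     else if card (\<beta> ` X) = 2 then (if \<exists>x\<in>X. \<forall>y\<in>X. \<beta> y = \<beta> x \<longrightarrow> y = x then 0 else 1)
     else if card (\<beta> ` X) = 3 then 1
     else 0)"

lemma block_colouring_3_1:
  assumes "\<beta> x = b" "\<beta> y = b" "\<beta> z = b" "\<beta> u \<noteq> b"
  shows "block_colouring \<beta> \<pi> f {x, y, z, u} = 0"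
  using assms by (auto simp: block_colouring_def card_insert_if)

lemma block_colouring_2_2_or_2_1_1:
  assumes "\<beta> x = b" "\<beta> y = b" "\<beta> u \<noteq> b" "\<beta> v \<noteq> b" "x \<noteq> y" "u \<noteq> v"
  shows "block_colouring \<beta> \<pi> f {x, y, u, v} = 1"
  using assms by (auto simp: block_colouring_def card_insert_if)

lemma block_colouring_transversal:
  assumes "inj_on \<beta> X" "card X = 4"
  shows "block_colouring \<beta> \<pi> f X = 0"
  using assms by (simp add: block_colouring_def card_image)

lemma block_colouring_funcset:
  assumes f: "f \<in> nsets V 4 \<rightarrow> {..<2}"
    and \<pi>: "\<pi> ` A \<subseteq> V" and inj: "inj_on (\<lambda>x. (\<beta> x, \<pi> x)) A"
  shows "block_colouring \<beta> \<pi> f \<in> nsets A 4 \<rightarrow> {..<2}"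
proof
  fix X assume X: "X \<in> nsets A 4"
  show "block_colouring \<beta> \<pi> f X \<in> {..<2}"
  proof (cases "card (\<beta> ` X) = 1")
    case True
    then obtain b where b: "\<beta> ` X = {b}"
      by (auto simp: card_1_singleton_iff)
    then have "\<beta> x = b" if "x \<in> X" for x
      using that by blast
    then have "inj_on \<pi> X"
      using inj X by (simp add: inj_on_def nsets_def subset_iff)
    with X \<pi> have "\<pi> ` X \<in> nsets V 4"
      by (auto simp: nsets_def card_image)
    with f True show ?thesis
      by (auto simp: block_colouring_def)
  qed (simp add: block_colouring_def)
qed

section \<open>Monochromatic sets of the block colouring\<close>

text \<open>
  Inside a block the new colouring is a copy of the old one, so monochromatic sets of size \<open>n\<close>
  excluded in \<open>V\<close> are excluded in every block.
\<close>

lemma card_fibre_less: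
  assumes no: "\<not> monochromatic V n 4 f i"
    and \<pi>: "\<pi> ` A \<subseteq> V" and inj: "inj_on (\<lambda>x. (\<beta> x, \<pi> x)) A"
    and H: "H \<subseteq> A" "finite H"
    and mono: "\<And>X. X \<in> nsets H 4 \<Longrightarrow> block_colouring \<beta> \<pi> f X = i"
  shows "card {x \<in> H. \<beta> x = b} < n"
proof (rule ccontr)
  assume "\<not> ?thesis"
  then obtain T where T: "T \<subseteq> {x \<in> H. \<beta> x = b}" "card T = n" "finite T"
    by (meson not_less obtain_subset_with_card_n)
  have injT: "inj_on \<pi> T"
    using inj T H by (simp add: inj_on_def subset_iff)
  moreover have "\<pi> ` T \<subseteq> V"
    using T(1) H(1) \<pi> by blast
  ultimately have "\<pi> ` T \<in> nsets V n"
    using T by (simp add: nsets_def card_image)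
  moreover have "f Y = i" if "Y \<in> nsets (\<pi> ` T) 4" for Y
  proof -
    have Y: "Y \<subseteq> \<pi> ` T" "card Y = 4"
      using that by (simp_all add: nsets_def)
    obtain X where X: "X \<subseteq> T" "Y = \<pi> ` X"
      using Y(1) by (rule subset_imageE)
    have card: "card X = 4"
      using X Y injT by (metis card_image inj_on_subset)
    have "X \<noteq> {}"
      using card by auto
    then have "\<beta> ` X = {b}"
      using X(1) T(1) by fast
    moreover have "X \<subseteq> H"
      using X(1) T(1) by fast
    then have "X \<in> nsets H 4"
      using H(2) card by (simp add: nsets_def finite_subset)
    ultimately show ?thesis
      using mono[of X] X by (simp add: block_colouring_def)
  qed
  ultimately have "monochromatic V n 4 f i"
    by (auto simp: monochromatic_def)
  with no show False ..
qed

text \<open>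
  The fibre bound excludes red \<open>p\<close>-sets inside a block; since a block with two points leaves room for
  at most one point outside it, a red set has at most \<open>(p - 1) + 1\<close> points.
\<close>

lemma card_red_le:
  assumes H: "finite H"
    and red: "\<And>X. X \<in> nsets H 4 \<Longrightarrow> block_colouring \<beta> \<pi> f X = 0"
    and fibre: "\<And>b. card {x \<in> H. \<beta> x = b} < p"
    and blocks: "card (\<beta> ` H) \<le> p"
  shows "card H \<le> p"
proof (cases "inj_on \<beta> H")
  case True
  with blocks show ?thesis
    by (simp add: card_image)
next
  case False
  then obtain x y where xy: "x \<in> H" "y \<in> H" "x \<noteq> y" "\<beta> y = \<beta> x"
    by (auto simp: inj_on_def)
  let ?F = "{z \<in> H. \<beta> z = \<beta> x}"
  have "u = v" if "u \<in> H - ?F" "v \<in> H - ?F" for u v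
  proof (rule ccontr)
    assume "u \<noteq> v"
    then have "{x, y, u, v} \<in> nsets H 4"
      using xy that by (auto simp: nsets_def card_insert_if)
    then show False
      using red block_colouring_2_2_or_2_1_1[of \<beta> x "\<beta> x" y u v \<pi> f] xy that \<open>u \<noteq> v\<close> by auto
  qed
  then have "card (H - ?F) \<le> 1"
    using H by (simp add: card_le_Suc0_iff_eq)
  moreover have "card H = card ?F + card (H - ?F)"
    using H by (simp add: card_Diff_subset card_mono)
  ultimately show ?thesis
    using fibre[of "\<beta> x"] by linarith
qed

text \<open>
  A blue set that meets several blocks has size at most \<open>2 * min m 3\<close>, as it contains
  no 4-set of type \<open>3+1\<close> or \<open>1+1+1+1\<close>.
\<close>

lemma card_blue_less:
  assumes H: "finite H"
    and blue: "\<And>X. X \<in> nsets H 4 \<Longrightarrow> block_colouring \<beta> \<pi> f X = 1"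
    and fibre: "\<And>b. card {x \<in> H. \<beta> x = b} < q"
    and blocks: "card (\<beta> ` H) \<le> m" and q: "2 * min m 3 < q"
  shows "card H < q"
proof (cases "\<exists>b. \<forall>x\<in>H. \<beta> x = b")
  case True
  then obtain b where "{x \<in> H. \<beta> x = b} = H"
    by auto
  with fibre[of b] show ?thesis
    by simp
next
  case False
  have fibre2: "card {x \<in> H. \<beta> x = b} \<le> 2" for b
  proof (rule ccontr)
    assume "\<not> ?thesis"
    then have "3 \<le> card {x \<in> H. \<beta> x = b}"
      by simp
    then obtain T where T: "T \<subseteq> {x \<in> H. \<beta> x = b}" "card T = 3"
      by (rule obtain_subset_with_card_n)
    then obtain x y z where xyz: "T = {x, y, z}" "x \<noteq> y" "x \<noteq> z" "y \<noteq> z"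
      by (auto simp: card_3_iff)
    from False obtain u where u: "u \<in> H" "\<beta> u \<noteq> b"
      by auto
    have "{x, y, z, u} \<in> nsets H 4"
      using T xyz u by (auto simp: nsets_def card_insert_if)
    then show False
      using blue block_colouring_3_1[of \<beta> x b y z u \<pi> f] T xyz u by auto
  qed
  have blocks3: "card (\<beta> ` H) \<le> 3"
  proof (rule ccontr)
    assume "\<not> ?thesis"
    then have "4 \<le> card (\<beta> ` H)"
      by simp
    then obtain B where B: "B \<subseteq> \<beta> ` H" "card B = 4"
      by (rule obtain_subset_with_card_n)
    then obtain X where X: "X \<subseteq> H" "inj_on \<beta> X" "\<beta> ` X = B"
      by (metis subset_image_inj)
    then have "card X = 4"
      using B by (metis card_image)
    moreover have "X \<in> nsets H 4"
      using X H \<open>card X = 4\<close> by (auto simp: nsets_def dest: finite_subset)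
    ultimately show False
      using blue X block_colouring_transversal[of \<beta> X \<pi> f] by auto
  qed
  have "card H = (\<Sum>b\<in>\<beta> ` H. card {x \<in> H. \<beta> x = b})"
    using sum.image_gen[OF H, of "\<lambda>_. 1 :: nat" \<beta>] by simp
  also have "\<dots> \<le> card (\<beta> ` H) * 2"
    using sum_bounded_above[of "\<beta> ` H" "\<lambda>b. card {x \<in> H. \<beta> x = b}" 2] fibre2 by simp
  also have "\<dots> \<le> 2 * min m 3"
    using blocks blocks3 by simp
  finally show ?thesis
    using q by simp
qed

section \<open>Lower bounds for partition relations and Ramsey numbers\<close>

text \<open>The injectivity hypothesis says that \<open>A\<close> embeds into \<open>\<beta> ` A \<times> V\<close>.\<close>

lemma not_partn_lst_blocks:
  assumes no: "\<not> partn_lst V [p, q] 4"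
    and \<pi>: "\<pi> ` A \<subseteq> V" and inj: "inj_on (\<lambda>x. (\<beta> x, \<pi> x)) A"
    and fin: "finite (\<beta> ` A)" and blocks: "card (\<beta> ` A) \<le> p" "2 * min (card (\<beta> ` A)) 3 < q"
  shows "\<not> partn_lst A [Suc p, q] 4"
proof
  assume *: "partn_lst A [Suc p, q] 4"
  from no obtain f where f: "f \<in> nsets V 4 \<rightarrow> {..<2}"
    and "\<And>i. i < 2 \<Longrightarrow> \<not> monochromatic V ([p, q] ! i) 4 f i"
    by (auto simp: partn_lst_def numeral_2_eq_2)
  from this(2)[of 0] this(2)[of 1]
  have no0: "\<not> monochromatic V p 4 f 0" and no1: "\<not> monochromatic V q 4 f 1"
    by simp_all
  have "block_colouring \<beta> \<pi> f \<in> nsets A 4 \<rightarrow> {..<length [Suc p, q]}"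
    using block_colouring_funcset[OF f \<pi> inj] by (simp add: numeral_2_eq_2)
  from partn_lstE[OF * this refl] obtain i H where i: "i < length [Suc p, q]"
    and H: "H \<in> nsets A ([Suc p, q] ! i)" and col: "block_colouring \<beta> \<pi> f ` nsets H 4 \<subseteq> {i}" .
  have HA: "H \<subseteq> A" "finite H" "card H = [Suc p, q] ! i"
    using H by (auto simp: nsets_def)
  have mono: "block_colouring \<beta> \<pi> f X = i" if "X \<in> nsets H 4" for X
    using col that by auto
  have le: "card (\<beta> ` H) \<le> card (\<beta> ` A)"
    using HA fin by (auto intro: card_mono)
  consider "i = 0" | "i = 1"
    using i by fastforce
  then show False
  proof cases
    case 1
    have "card {x \<in> H. \<beta> x = b} < p" for b
      using card_fibre_less[OF no0 \<pi> inj HA(1,2)] mono 1 by blast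
    then have "card H \<le> p"
      using card_red_le[of H \<beta> \<pi> f p] HA(2) mono 1 le blocks(1) by simp
    with HA(3) 1 show False
      by simp
  next
    case 2
    have "card {x \<in> H. \<beta> x = b} < q" for b
      using card_fibre_less[OF no1 \<pi> inj HA(1,2)] mono 2 by blast
    then have "card H < q"
      using card_blue_less[of H \<beta> \<pi> f q, OF _ _ _ le blocks(2)] HA(2) mono 2 by simp
    with HA(3) 2 show False
      by simp
  qed
qed

lemma not_partn_lst_multiple:
  assumes no: "\<not> partn_lst {1..N} [p, q] 4" and m: "m \<le> p" "2 * min m 3 < q"
  shows "\<not> partn_lst {1..m * N} [Suc p, q] 4"
proof -
  \<comment> \<open>The interval is cut into \<open>m\<close> consecutive blocks of length \<open>N\<close>; the shifts by one are due to
    its starting at \<open>1\<close>.\<close>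
  define \<beta> where "\<beta> = (\<lambda>x::nat. (x - 1) div N)"
  define \<pi> where "\<pi> = (\<lambda>x::nat. (x - 1) mod N + 1)"
  have sub: "\<beta> ` {1..m * N} \<subseteq> {..<m}"
    by (auto simp: \<beta>_def less_mult_imp_div_less)
  then have card: "card (\<beta> ` {1..m * N}) \<le> m"
    by (metis card_lessThan card_mono finite_lessThan)
  have "\<pi> ` {1..m * N} \<subseteq> {1..N}"
    by (auto simp: \<pi>_def Suc_le_eq intro!: mod_less_divisor Nat.gr0I)
  moreover have "inj_on (\<lambda>x. (\<beta> x, \<pi> x)) {1..m * N}"
  proof (rule inj_onI)
    fix x y
    assume "x \<in> {1..m * N}" "y \<in> {1..m * N}" and "(\<beta> x, \<pi> x) = (\<beta> y, \<pi> y)"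
    moreover from this have "x - 1 = y - 1"
      by (metis \<beta>_def \<pi>_def Pair_inject add_right_cancel div_mult_mod_eq)
    ultimately show "x = y"
      by auto
  qed
  moreover have "2 * min (card (\<beta> ` {1..m * N})) 3 < q"
    using card m(2) by linarith
  ultimately show ?thesis
    using not_partn_lst_blocks[OF no, of \<pi> _ \<beta>] card m(1) by simp
qed

lemma partn_lst_mono:
  assumes part: "partn_lst A \<alpha> k" and AB: "A \<subseteq> B"
  shows "partn_lst B \<alpha> k"
  unfolding partn_lst_def
proof
  fix f assume "f \<in> nsets B k \<rightarrow> {..<length \<alpha>}"
  then have "f \<in> nsets A k \<rightarrow> {..<length \<alpha>}"
    using nsets_Pi_contra[OF AB] by (rule subsetD[rotated])
  with part obtain i where "i < length \<alpha>" "monochromatic A (\<alpha> ! i) k f i"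
    unfolding partn_lst_def by blast
  then show "\<exists>i<length \<alpha>. monochromatic B (\<alpha> ! i) k f i"
    using nsets_mono[OF AB] unfolding monochromatic_def by blast
qed

lemma ramsey_number_multiple:
  assumes m: "1 \<le> m" "m \<le> p - 1" "2 * min m 3 < q"
  shows "int (ramsey_number 4 p q) \<ge> int m * (int (ramsey_number 4 (p - 1) q) - 1) + 1"
proof -
  let ?r = "ramsey_number 4 (p - 1) q"
  show ?thesis
  proof (cases "?r = 0")
    \<comment> \<open>Here the right-hand side is \<open>1 - m \<le> 0\<close>.\<close>
    case True
    with m(1) show ?thesis
      by simp
  next
    case False
    have no: "\<not> partn_lst {1..?r - 1} [p - 1, q] 4"
      using ramsey_number_le[of "?r - 1" "p - 1" q 4] False by linarith
    have "\<not> partn_lst {1..m * (?r - 1)} [p, q] 4"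
      using not_partn_lst_multiple[OF no m(2,3)] m by simp
    then have "m * (?r - 1) < ramsey_number 4 p q"
      using partn_lst_mono[OF partn_lst_ramsey_number[of 4 p q], of "{1..m * (?r - 1)}"] by fastforce
    then have "int (m * (?r - 1)) + 1 \<le> int (ramsey_number 4 p q)"
      by linarith
    then show ?thesis
      using False by simp
  qed
qed

theorem theorem1:
  shows "(\<forall>p q :: nat. p \<ge> 6 \<and> q \<ge> 5 \<longrightarrow>
            int (ramsey_number 4 p q) \<ge> 2 * int (ramsey_number 4 (p - 1) q) - 1) \<and>
         (\<forall>p q :: nat. p \<ge> 6 \<and> q \<ge> 7 \<longrightarrow>
            int (ramsey_number 4 p q) \<ge> (int p - 1) * (int (ramsey_number 4 (p - 1) q) - 1) + 1)"
proof (intro conjI allI impI; elim conjE)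
  fix p q :: nat
  assume "6 \<le> p" "5 \<le> q"
  then show "int (ramsey_number 4 p q) \<ge> 2 * int (ramsey_number 4 (p - 1) q) - 1"
    using ramsey_number_multiple[of 2 p q] by simp
next
  fix p q :: nat
  assume "6 \<le> p" "7 \<le> q"
  then show "int (ramsey_number 4 p q) \<ge> (int p - 1) * (int (ramsey_number 4 (p - 1) q) - 1) + 1"
    using ramsey_number_multiple[of "p - 1" p q] by simp
qed

end
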